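(* Suppose that $(\mathcal{P},\mathcal{I})$ is a projective class on a triangulated category $\mathbb{T}$, and that \[ X \xrightarrow{\alpha} Y \xrightarrow{\beta} Z \xrightarrow{\gamma} \Sigma X \] is a distinguished triangle with $\beta$ right almost split. If $Z$ has finite length $l$ and $X$ has finite length $k$ with respect to $(\mathcal{P},\mathcal{I})$, then the third map $\gamma$ is in $\mathcal{I}^{l-1}$, and \begin{align*} k-1 \le \mathrm{len}_{\mathcal{P}}(Y) &\le k+1, && \text{if } k \ge l;\\ l-1 \le \mathrm{len}_{\mathcal{P}}(Y) &\le l, && \text{if } k \le l-1. \end{align*} For any summand $S$ of $Y$, $\mathrm{len}_{\mathcal{P}}(S) \le \max(k+1,l)$.
   Context: A (stable) projective class in a triangulated category $\mathbb{T}$ consists of a class $\mathcal{P}$ of objects and a class $\mathcal{I}$ of morphisms such that: (i) $\mathcal{P}$ consists of exactly the objects $P$ such that every composite $P\to X\to Y$ is zero for each $X\to Y$ in $\mathcal{I}$; (ii) $\mathcal{I}$ consists of exactly the maps $X\to Y$ such that every composite $P\to X\to Y$ is zero for each $P\in\mathcal{P}$; (iii) for each $X$ in $\mathbb{T}$ there is a cofibre sequence (distinguished triangle) $P\to X\to Y$ with $P\in\mathcal{P}$ and $X\to Y$ in $\mathcal{I}$; and $\mathcal{P}$ (equivalently $\mathcal{I}$) is closed under suspension and desuspension. $\mathcal{I}^n$ is the ideal of all $n$-fold composites of maps in $\mathcal{I}$, with $\mathcal{I}^0$ all maps of $\mathbb{T}$. $\mathcal{P}_0$ consists of all zero objects,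 $\mathcal{P}_1=\mathcal{P}$, and $X\in\mathcal{P}_n$ iff $X$ is a retract of an object $M$ in a cofibre sequence $P\to M\to Q$ with $P\in\mathcal{P}$ and $Q\in\mathcal{P}_{n-1}$. Each $(\mathcal{P}_n,\mathcal{I}^n)$ is a projective class. The length $\mathrm{len}_{\mathcal{P}}(X)$ is the smallest $n$ with $X\in\mathcal{P}_n$, if it exists (equivalently, the smallest $n$ such that every map in $\mathcal{I}^n$ with domain $X$ is zero). A map $\beta:Y\to Z$ is right almost split if it is not split epic and every map $Y'\to Z$ that is not split epic factors through $\beta$. *)

theory Defs
  imports "HOL-Algebra.Group" "HOL-Library.Extended_Nat"
begin

text \<open>
  The objects and the morphisms of a category are the elements of two (arbitrary) types.
  \<open>Dom\<close> and \<open>Cod\<close> are total, so every morphism has a unique source and target, and a class of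
  morphisms is simply a set. Composition is written in the usual order
  (\<open>g \<cdot> f\<close> is first \<open>f\<close>, then \<open>g\<close>); it and the sum of morphisms are only meaningful on
  composable, respectively parallel, morphisms. \<open>Tri\<close> is the class of distinguished triangles.
\<close>

record ('o, 'm) tricat =
  Dom :: "'m \<Rightarrow> 'o"
  Cod :: "'m \<Rightarrow> 'o"
  Idn :: "'o \<Rightarrow> 'm"
  Cmp :: "'m \<Rightarrow> 'm \<Rightarrow> 'm"  (infixr \<open>\<cdot>\<index>\<close> 70)
  Zer :: "'o \<Rightarrow> 'o \<Rightarrow> 'm"
  Pls :: "'m \<Rightarrow> 'm \<Rightarrow> 'm"  (infixl \<open>\<^bold>+\<index>\<close> 65)
  Susp :: "'o \<Rightarrow> 'o"
  SuspM :: "'m \<Rightarrow> 'm"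
  Tri :: "('m \<times> 'm \<times> 'm) set"

definition Hom :: "('o, 'm) tricat \<Rightarrow> 'o \<Rightarrow> 'o \<Rightarrow> 'm set" where
  "Hom T X Y = {f. Dom T f = X \<and> Cod T f = Y}"

locale category =
  fixes T :: "('o, 'm) tricat" (structure)
  assumes idn_hom: "Idn T X \<in> Hom T X X"
    and cmp_hom: "\<lbrakk>f \<in> Hom T X Y; g \<in> Hom T Y Z\<rbrakk> \<Longrightarrow> g \<cdot> f \<in> Hom T X Z"
    and cmp_idn: "f \<in> Hom T X Y \<Longrightarrow> f \<cdot> Idn T X = f"
    and idn_cmp: "f \<in> Hom T X Y \<Longrightarrow> Idn T Y \<cdot> f = f"
    and cmp_assoc: "\<lbrakk>f \<in> Hom T W X; g \<in> Hom T X Y; h \<in> Hom T Y Z\<rbrakk>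
          \<Longrightarrow> (h \<cdot> g) \<cdot> f = h \<cdot> (g \<cdot> f)"

definition inverse_pair :: "('o, 'm) tricat \<Rightarrow> 'o \<Rightarrow> 'o \<Rightarrow> 'm \<Rightarrow> 'm \<Rightarrow> bool" where
  "inverse_pair T X Y f g \<longleftrightarrow> f \<in> Hom T X Y \<and> g \<in> Hom T Y X
     \<and> g \<cdot>\<^bsub>T\<^esub> f = Idn T X \<and> f \<cdot>\<^bsub>T\<^esub> g = Idn T Y"

definition iso_mor :: "('o, 'm) tricat \<Rightarrow> 'm \<Rightarrow> bool" where
  "iso_mor T f \<longleftrightarrow> (\<exists>g. inverse_pair T (Dom T f) (Cod T f) f g)"

definition isomorphic :: "('o, 'm) tricat \<Rightarrow> 'o \<Rightarrow> 'o \<Rightarrow> bool" where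
  "isomorphic T X Y \<longleftrightarrow> (\<exists>f \<in> Hom T X Y. iso_mor T f)"

definition retract :: "('o, 'm) tricat \<Rightarrow> 'o \<Rightarrow> 'o \<Rightarrow> bool" where
  "retract T X M \<longleftrightarrow> (\<exists>i \<in> Hom T X M. \<exists>r \<in> Hom T M X. r \<cdot>\<^bsub>T\<^esub> i = Idn T X)"

definition split_epi :: "('o, 'm) tricat \<Rightarrow> 'm \<Rightarrow> bool" where
  "split_epi T f \<longleftrightarrow> (\<exists>s \<in> Hom T (Cod T f) (Dom T f). f \<cdot>\<^bsub>T\<^esub> s = Idn T (Cod T f))"

definition right_almost_split :: "('o, 'm) tricat \<Rightarrow> 'm \<Rightarrow> bool" where
  "right_almost_split T \<beta> \<longleftrightarrow> \<not> split_epi T \<beta>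
     \<and> (\<forall>f. Cod T f = Cod T \<beta> \<and> \<not> split_epi T f
            \<longrightarrow> (\<exists>g \<in> Hom T (Dom T f) (Dom T \<beta>). \<beta> \<cdot>\<^bsub>T\<^esub> g = f))"

definition zero_obj :: "('o, 'm) tricat \<Rightarrow> 'o \<Rightarrow> bool" where
  "zero_obj T X \<longleftrightarrow> (\<forall>Y. (\<exists>!f. f \<in> Hom T X Y) \<and> (\<exists>!f. f \<in> Hom T Y X))"

text \<open>Hom-sets as groups; the library's multiplicative notation stands for the addition.\<close>

definition hom_group :: "('o, 'm) tricat \<Rightarrow> 'o \<Rightarrow> 'o \<Rightarrow> 'm monoid" where
  "hom_group T X Y = \<lparr>carrier = Hom T X Y, monoid.mult = Pls T, one = Zer T X Y\<rparr>"

definition neg :: "('o, 'm) tricat \<Rightarrow> 'm \<Rightarrow> 'm" where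
  "neg T f = inv\<^bsub>hom_group T (Dom T f) (Cod T f)\<^esub> f"

definition biproduct ::
    "('o, 'm) tricat \<Rightarrow> 'o \<Rightarrow> 'o \<Rightarrow> 'o \<Rightarrow> 'm \<Rightarrow> 'm \<Rightarrow> 'm \<Rightarrow> 'm \<Rightarrow> bool" where
  "biproduct T A B C i j p q \<longleftrightarrow>
     i \<in> Hom T A C \<and> j \<in> Hom T B C \<and> p \<in> Hom T C A \<and> q \<in> Hom T C B
     \<and> p \<cdot>\<^bsub>T\<^esub> i = Idn T A \<and> q \<cdot>\<^bsub>T\<^esub> j = Idn T B
     \<and> p \<cdot>\<^bsub>T\<^esub> j = Zer T B A \<and> q \<cdot>\<^bsub>T\<^esub> i = Zer T A B
     \<and> i \<cdot>\<^bsub>T\<^esub> p \<^bold>+\<^bsub>T\<^esub> j \<cdot>\<^bsub>T\<^esub> q = Idn T C"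

definition summand :: "('o, 'm) tricat \<Rightarrow> 'o \<Rightarrow> 'o \<Rightarrow> bool" where
  "summand T S Y \<longleftrightarrow> (\<exists>S' i j p q. biproduct T S S' Y i j p q)"

locale additive_category = category +
  assumes hom_comm_group: "comm_group (hom_group T X Y)"
    and cmp_add_left: "\<lbrakk>f \<in> Hom T X Y; g \<in> Hom T Y Z; g' \<in> Hom T Y Z\<rbrakk>
          \<Longrightarrow> (g \<^bold>+ g') \<cdot> f = g \<cdot> f \<^bold>+ g' \<cdot> f"
    and cmp_add_right: "\<lbrakk>f \<in> Hom T X Y; f' \<in> Hom T X Y; g \<in> Hom T Y Z\<rbrakk>
          \<Longrightarrow> g \<cdot> (f \<^bold>+ f') = g \<cdot> f \<^bold>+ g \<cdot> f'"
    and ex_zero_obj: "\<exists>X. zero_obj T X"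
    and ex_biproduct: "\<exists>C i j p q. biproduct T A B C i j p q"

definition candidate :: "('o, 'm) tricat \<Rightarrow> 'm \<Rightarrow> 'm \<Rightarrow> 'm \<Rightarrow> bool" where
  "candidate T f g h \<longleftrightarrow>
     Cod T f = Dom T g \<and> Cod T g = Dom T h \<and> Cod T h = Susp T (Dom T f)"

definition triangle_mor ::
    "('o, 'm) tricat \<Rightarrow> 'm \<times> 'm \<times> 'm \<Rightarrow> 'm \<times> 'm \<times> 'm \<Rightarrow> 'm \<times> 'm \<times> 'm \<Rightarrow> bool" where
  "triangle_mor T t t' m \<longleftrightarrow>
     (case t of (f, g, h) \<Rightarrow> case t' of (f', g', h') \<Rightarrow> case m of (a, b, c) \<Rightarrow>
        a \<in> Hom T (Dom T f) (Dom T f') \<and> b \<in> Hom T (Dom T g) (Dom T g')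
        \<and> c \<in> Hom T (Dom T h) (Dom T h')
        \<and> b \<cdot>\<^bsub>T\<^esub> f = f' \<cdot>\<^bsub>T\<^esub> a \<and> c \<cdot>\<^bsub>T\<^esub> g = g' \<cdot>\<^bsub>T\<^esub> b
        \<and> SuspM T a \<cdot>\<^bsub>T\<^esub> h = h' \<cdot>\<^bsub>T\<^esub> c)"

text \<open>
  The suspension is an additive auto-equivalence (fully faithful and essentially surjective), not
  necessarily an automorphism. In the octahedral axiom the three given triangles start with
  \<open>f\<close>, \<open>g\<close> and \<open>g \<cdot> f\<close>.
\<close>

locale triangulated_category = additive_category +
  assumes susp_hom: "f \<in> Hom T X Y \<Longrightarrow> SuspM T f \<in> Hom T (Susp T X) (Susp T Y)"
    and susp_idn: "SuspM T (Idn T X) = Idn T (Susp T X)"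
    and susp_cmp: "\<lbrakk>f \<in> Hom T X Y; g \<in> Hom T Y Z\<rbrakk>
          \<Longrightarrow> SuspM T (g \<cdot> f) = SuspM T g \<cdot> SuspM T f"
    and susp_add: "\<lbrakk>f \<in> Hom T X Y; f' \<in> Hom T X Y\<rbrakk>
          \<Longrightarrow> SuspM T (f \<^bold>+ f') = SuspM T f \<^bold>+ SuspM T f'"
    and susp_ff: "bij_betw (SuspM T) (Hom T X Y) (Hom T (Susp T X) (Susp T Y))"
    and susp_es: "\<exists>X. isomorphic T (Susp T X) Y"
    and tri_candidate: "(f, g, h) \<in> Tri T \<Longrightarrow> candidate T f g h"
    and TR1_iso: "\<lbrakk>(f, g, h) \<in> Tri T; candidate T f' g' h';
            triangle_mor T (f, g, h) (f', g', h') (a, b, c);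
            iso_mor T a; iso_mor T b; iso_mor T c\<rbrakk> \<Longrightarrow> (f', g', h') \<in> Tri T"
    and TR1_idn: "zero_obj T N \<Longrightarrow> (Idn T X, Zer T X N, Zer T N (Susp T X)) \<in> Tri T"
    and TR1_ex: "\<exists>g h. (f, g, h) \<in> Tri T"
    and TR2: "candidate T f g h
          \<Longrightarrow> (f, g, h) \<in> Tri T \<longleftrightarrow> (g, h, neg T (SuspM T f)) \<in> Tri T"
    and TR3: "\<lbrakk>(f, g, h) \<in> Tri T; (f', g', h') \<in> Tri T;
            a \<in> Hom T (Dom T f) (Dom T f'); b \<in> Hom T (Cod T f) (Cod T f');
            b \<cdot> f = f' \<cdot> a\<rbrakk> \<Longrightarrow> \<exists>c. triangle_mor T (f, g, h) (f', g', h') (a, b, c)"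
    and TR4: "\<lbrakk>Cod T f = Dom T g;
            (f, f1, f2) \<in> Tri T; (g, g1, g2) \<in> Tri T; (g \<cdot> f, h1, h2) \<in> Tri T\<rbrakk>
          \<Longrightarrow> \<exists>a b. (a, b, SuspM T f1 \<cdot> g2) \<in> Tri T
            \<and> triangle_mor T (f, f1, f2) (g \<cdot> f, h1, h2) (Idn T (Dom T f), g, a)
            \<and> triangle_mor T (g \<cdot> f, h1, h2) (g, g1, g2) (f, Idn T (Cod T g), b)"

text \<open>
  Stable projective classes. Since the suspension is only an equivalence, a desuspension of
  \<open>A\<close> is any object \<open>B\<close> whose suspension is isomorphic to \<open>A\<close>.
\<close>

definition projective_class :: "('o, 'm) tricat \<Rightarrow> 'o set \<Rightarrow> 'm set \<Rightarrow> bool" where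
  "projective_class T P I \<longleftrightarrow>
     P = {A. \<forall>f \<in> I. \<forall>p \<in> Hom T A (Dom T f). f \<cdot>\<^bsub>T\<^esub> p = Zer T A (Cod T f)}
     \<and> I = {f. \<forall>A \<in> P. \<forall>p \<in> Hom T A (Dom T f). f \<cdot>\<^bsub>T\<^esub> p = Zer T A (Cod T f)}
     \<and> (\<forall>X. \<exists>A Y p f h. A \<in> P \<and> f \<in> I \<and> p \<in> Hom T A X \<and> f \<in> Hom T X Y \<and> (p, f, h) \<in> Tri T)
     \<and> (\<forall>A \<in> P. Susp T A \<in> P)
     \<and> (\<forall>A \<in> P. \<forall>B. isomorphic T (Susp T B) A \<longrightarrow> B \<in> P)"

fun ideal_pow :: "('o, 'm) tricat \<Rightarrow> 'm set \<Rightarrow> nat \<Rightarrow> 'm set" where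
  "ideal_pow T I 0 = UNIV"
| "ideal_pow T I (Suc 0) = I"
| "ideal_pow T I (Suc (Suc n)) =
     {g \<cdot>\<^bsub>T\<^esub> f | f g. f \<in> ideal_pow T I (Suc n) \<and> g \<in> I \<and> Cod T f = Dom T g}"

fun proj_pow :: "('o, 'm) tricat \<Rightarrow> 'o set \<Rightarrow> nat \<Rightarrow> 'o set" where
  "proj_pow T P 0 = {X. zero_obj T X}"
| "proj_pow T P (Suc 0) = P"
| "proj_pow T P (Suc (Suc n)) =
     {X. \<exists>M A Q f g h. retract T X M \<and> A \<in> P \<and> Q \<in> proj_pow T P (Suc n)
         \<and> f \<in> Hom T A M \<and> g \<in> Hom T M Q \<and> (f, g, h) \<in> Tri T}"

text \<open>The length is \<open>\<infinity>\<close> when the object lies in no \<open>proj_pow T P n\<close>.\<close>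

definition len :: "('o, 'm) tricat \<Rightarrow> 'o set \<Rightarrow> 'o \<Rightarrow> enat" where
  "len T P X = (if \<exists>n. X \<in> proj_pow T P n then enat (LEAST n. X \<in> proj_pow T P n) else \<infinity>)"

end

theory Submission
  imports Defs
begin

text \<open>
  The whole argument uses two facts on \<open>P\<^sub>n = proj_pow T P n\<close> and \<open>I\<^sup>n = ideal_pow T I n\<close>, which,
  as \<open>P\<^sub>n\<close> is closed under retracts, make them a projective class: every map in \<open>I\<^sup>n\<close> out of an object of \<open>P\<^sub>n\<close> is zero
  (\<open>proj_pow_ideal_pow_zer\<close>), and every \<open>X\<close> lies in a triangle \<open>F \<rightarrow> X \<rightarrow> W\<close> with \<open>F\<close> in \<open>P\<^sub>n\<close> and
  \<open>X \<rightarrow> W\<close> in \<open>I\<^sup>n\<close> (\<open>ex_proj_pow_tri\<close>, by the octahedral axiom). Consequently \<open>X\<close> lies in \<open>P\<^sub>n\<close> as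
  soon as every map in \<open>I\<^sup>n\<close> out of \<open>X\<close> is zero (\<open>proj_powI\<close>), so that lengths can be bounded by
  showing that maps vanish.

  Almost splitness enters through \<open>ideal_pow_if_cmp_right_almost_split\<close>: if \<open>Z\<close> is not in \<open>P\<^sub>n\<close>, then a
  map \<open>t\<close> out of \<open>Z\<close> is in \<open>I\<^sup>n\<close> as soon as \<open>t \<cdot> \<beta>\<close> is. Indeed, in the triangle \<open>F \<rightarrow> Z \<rightarrow> W\<close> the first
  map cannot be split epic and therefore factors through \<open>\<beta>\<close>; so \<open>t\<close> vanishes on \<open>F\<close> and factors through
  \<open>Z \<rightarrow> W\<close>. With \<open>n = l - 1\<close> and \<open>t = \<gamma>\<close>, where \<open>\<gamma> \<cdot> \<beta> = 0\<close>, this shows that \<open>\<gamma>\<close> is in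
  \<open>I\<^sup>l\<^sup>-\<^sup>1\<close>. A composite of \<open>\<gamma>\<close>, or of any other such \<open>t\<close>, with one more map of \<open>I\<close> is then in \<open>I\<^sup>l\<close>,
  hence zero because it starts at \<open>Z\<close>.

  All bounds come from this vanishing. It costs only one factor from \<open>I\<close>, where extensions in general
  only give \<open>len Y \<le> k + l\<close>, \<open>l \<le> len Y + k\<close> and \<open>k \<le> len Y + l\<close>. The bounds obtained are
  \<open>len Y \<le> max (k + 1) l\<close> (\<open>Y_proj_pow\<close>), \<open>l \<le> len Y + 1\<close> (\<open>Z_proj_pow_Suc\<close>) and \<open>k \<le> len Y + 1\<close>
  (\<open>X_proj_pow_Suc\<close>), and both cases of the theorem are instances. A summand of \<open>Y\<close> inherits
  the upper bound, because \<open>P\<^sub>n\<close> is closed under retracts.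
\<close>

section \<open>Hom-groups and zero objects\<close>

lemma mem_Hom_iff: "f \<in> Hom T X Y \<longleftrightarrow> Dom T f = X \<and> Cod T f = Y"
  by (simp add: Hom_def)

context category
begin

lemma retract_trans:
  assumes "retract T X Y" "retract T Y Z"
  shows "retract T X Z"
proof -
  obtain i r where ir: "i \<in> Hom T X Y" "r \<in> Hom T Y X" "r \<cdot> i = Idn T X"
    using assms(1) by (auto simp: retract_def)
  obtain j s where js: "j \<in> Hom T Y Z" "s \<in> Hom T Z Y" "s \<cdot> j = Idn T Y"
    using assms(2) by (auto simp: retract_def)
  have "(r \<cdot> s) \<cdot> (j \<cdot> i) = r \<cdot> (s \<cdot> (j \<cdot> i))"
    by (rule cmp_assoc[OF cmp_hom[OF ir(1) js(1)] js(2) ir(2)])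
  also have "s \<cdot> (j \<cdot> i) = (s \<cdot> j) \<cdot> i" by (rule cmp_assoc[OF ir(1) js(1,2), symmetric])
  also have "r \<cdot> ((s \<cdot> j) \<cdot> i) = Idn T X" by (simp add: js(3) idn_cmp[OF ir(1)] ir(3))
  finally show ?thesis
    unfolding retract_def using cmp_hom ir js by blast
qed

end

context additive_category
begin

lemma zer_hom: "Zer T X Y \<in> Hom T X Y"
proof -
  interpret comm_group "hom_group T X Y" by (rule hom_comm_group)
  show ?thesis using one_closed by (simp add: hom_group_def)
qed

lemma idempotent_zer: "\<lbrakk>f \<in> Hom T X Y; f \<^bold>+ f = f\<rbrakk> \<Longrightarrow> f = Zer T X Y"
proof -
  interpret comm_group "hom_group T X Y" by (rule hom_comm_group)
  assume "f \<in> Hom T X Y" "f \<^bold>+ f = f"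
  then show ?thesis using l_cancel_one[of f f] by (simp add: hom_group_def)
qed

lemma zer_add_zer: "Zer T X Y \<^bold>+ Zer T X Y = Zer T X Y"
proof -
  interpret comm_group "hom_group T X Y" by (rule hom_comm_group)
  show ?thesis using l_one[OF one_closed] by (simp add: hom_group_def)
qed

lemma zer_cmp: "f \<in> Hom T X Y \<Longrightarrow> Zer T Y Z \<cdot> f = Zer T X Z"
  using cmp_add_left[of f X Y "Zer T Y Z" Z "Zer T Y Z"]
  by (intro idempotent_zer) (simp_all add: zer_hom zer_add_zer cmp_hom[of f X Y])

lemma cmp_zer: "g \<in> Hom T Y Z \<Longrightarrow> g \<cdot> Zer T X Y = Zer T X Z"
  using cmp_add_right[of "Zer T X Y" X Y "Zer T X Y" g Z]
  by (intro idempotent_zer) (simp_all add: zer_hom zer_add_zer cmp_hom[of _ X Y])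

lemma zero_obj_hom:
  assumes "zero_obj T N"
  shows "f \<in> Hom T N X \<Longrightarrow> f = Zer T N X" and "f \<in> Hom T X N \<Longrightarrow> f = Zer T X N"
  using assms zer_hom[of N X] zer_hom[of X N] unfolding zero_obj_def by blast+

lemma zero_obj_if_Idn_zer:
  assumes "Idn T X = Zer T X X"
  shows "zero_obj T X"
  unfolding zero_obj_def
proof (intro allI conjI)
  fix Y
  show "\<exists>!f. f \<in> Hom T X Y"
    by (rule ex1I[of _ "Zer T X Y"]) (use assms zer_hom cmp_idn cmp_zer in metis)+
  show "\<exists>!f. f \<in> Hom T Y X"
    by (rule ex1I[of _ "Zer T Y X"]) (use assms zer_hom idn_cmp zer_cmp in metis)+
qed

lemma zero_obj_if_retract:
  assumes "retract T X N" and N: "zero_obj T N"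
  shows "zero_obj T X"
proof -
  obtain i r where i: "i \<in> Hom T X N" and r: "r \<in> Hom T N X" and ri: "r \<cdot> i = Idn T X"
    using assms(1) by (auto simp: retract_def)
  have "Idn T X = r \<cdot> Zer T X N" using ri zero_obj_hom(2)[OF N i] by simp
  then show ?thesis using cmp_zer[OF r] zero_obj_if_Idn_zer by simp
qed

lemma neg_hom: "f \<in> Hom T X Y \<Longrightarrow> neg T f \<in> Hom T X Y"
proof -
  interpret comm_group "hom_group T X Y" by (rule hom_comm_group)
  assume "f \<in> Hom T X Y"
  then show ?thesis using inv_closed[of f] by (simp add: neg_def hom_group_def mem_Hom_iff)
qed

lemma neg_add: "f \<in> Hom T X Y \<Longrightarrow> neg T f \<^bold>+ f = Zer T X Y"
proof -
  interpret comm_group "hom_group T X Y" by (rule hom_comm_group)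
  assume "f \<in> Hom T X Y"
  then show ?thesis using l_inv[of f] by (simp add: neg_def hom_group_def mem_Hom_iff)
qed

lemma neg_eqI: "\<lbrakk>g \<^bold>+ f = Zer T X Y; f \<in> Hom T X Y; g \<in> Hom T X Y\<rbrakk> \<Longrightarrow> neg T f = g"
proof -
  interpret comm_group "hom_group T X Y" by (rule hom_comm_group)
  assume "g \<^bold>+ f = Zer T X Y" "f \<in> Hom T X Y" "g \<in> Hom T X Y"
  then show ?thesis using inv_equality[of g f] by (simp add: neg_def hom_group_def mem_Hom_iff)
qed

lemma neg_neg: "f \<in> Hom T X Y \<Longrightarrow> neg T (neg T f) = f"
proof -
  interpret comm_group "hom_group T X Y" by (rule hom_comm_group)
  assume f: "f \<in> Hom T X Y"
  then show ?thesis using inv_inv[of f] neg_hom[OF f]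
    by (simp add: neg_def hom_group_def mem_Hom_iff)
qed

lemma neg_cmp: "\<lbrakk>f \<in> Hom T X Y; g \<in> Hom T Y Z\<rbrakk> \<Longrightarrow> neg T g \<cdot> f = neg T (g \<cdot> f)"
  using cmp_add_left[of f X Y "neg T g" Z g]
  by (intro neg_eqI[symmetric, of _ _ X Z]) (simp_all add: neg_hom cmp_hom[of f X Y] neg_add zer_cmp)

lemma cmp_neg: "\<lbrakk>f \<in> Hom T X Y; g \<in> Hom T Y Z\<rbrakk> \<Longrightarrow> g \<cdot> neg T f = neg T (g \<cdot> f)"
  using cmp_add_right[of "neg T f" X Y f g Z]
  by (intro neg_eqI[symmetric, of _ _ X Z]) (simp_all add: neg_hom cmp_hom[of _ X Y] neg_add cmp_zer)

end

section \<open>Distinguished triangles\<close>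

context triangulated_category
begin

lemma susp_zer: "SuspM T (Zer T X Y) = Zer T (Susp T X) (Susp T Y)"
  using susp_add[of "Zer T X Y" X Y "Zer T X Y"]
  by (intro idempotent_zer susp_hom zer_hom) (simp add: zer_hom zer_add_zer)

lemma susp_neg: "f \<in> Hom T X Y \<Longrightarrow> SuspM T (neg T f) = neg T (SuspM T f)"
  using susp_add[of "neg T f" X Y f]
  by (intro neg_eqI[symmetric, of _ _ "Susp T X" "Susp T Y"])
    (simp_all add: susp_hom neg_hom neg_add susp_zer)

lemma susp_faithful:
  "\<lbrakk>f \<in> Hom T X Y; g \<in> Hom T X Y; SuspM T f = SuspM T g\<rbrakk> \<Longrightarrow> f = g"
  using susp_ff[of X Y] by (auto simp: bij_betw_def inj_on_def)

lemma susp_full: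
  assumes "g \<in> Hom T (Susp T X) (Susp T Y)"
  obtains f where "f \<in> Hom T X Y" "g = SuspM T f"
  using susp_ff[of X Y] assms by (auto simp: bij_betw_def)

lemma zero_obj_susp: "zero_obj T N \<Longrightarrow> zero_obj T (Susp T N)"
  using zero_obj_hom(1)[OF _ idn_hom] zero_obj_if_Idn_zer susp_zer susp_idn by metis

lemma tri_hom:
  assumes "(f, g, h) \<in> Tri T" "f \<in> Hom T A B" "g \<in> Hom T B C"
  shows "h \<in> Hom T C (Susp T A)"
  using tri_candidate[OF assms(1)] assms(2,3) by (simp add: candidate_def mem_Hom_iff)

lemma tri_rotate: "(f, g, h) \<in> Tri T \<Longrightarrow> (g, h, neg T (SuspM T f)) \<in> Tri T"
  using TR2 tri_candidate by blast

lemma tri_rotate_back: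
  assumes "(g, h, neg T (SuspM T f)) \<in> Tri T"
    and "f \<in> Hom T A B" "g \<in> Hom T B C" "h \<in> Hom T C (Susp T A)"
  shows "(f, g, h) \<in> Tri T"
proof -
  have "candidate T f g h" using assms(2-) by (simp add: candidate_def mem_Hom_iff)
  then show ?thesis using assms(1) TR2 by blast
qed

lemma tri_zer_idn:
  assumes N: "zero_obj T N"
  shows "(Zer T N X, Idn T X, Zer T X (Susp T N)) \<in> Tri T"
proof (rule tri_rotate_back[OF _ zer_hom idn_hom zer_hom])
  have "neg T (SuspM T (Zer T N X)) = Zer T (Susp T N) (Susp T X)"
    by (intro zero_obj_hom(1)[OF zero_obj_susp[OF N]] neg_hom susp_hom zer_hom)
  then show "(Idn T X, Zer T X (Susp T N), neg T (SuspM T (Zer T N X))) \<in> Tri T"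
    using TR1_idn[OF zero_obj_susp[OF N]] by simp
qed

lemma tri_cmp_zer:
  assumes t: "(f, g, h) \<in> Tri T" and f: "f \<in> Hom T A B" and g: "g \<in> Hom T B C"
  shows "g \<cdot> f = Zer T A C"
proof -
  obtain N where N: "zero_obj T N" using ex_zero_obj by blast
  have "\<exists>c. triangle_mor T (Idn T A, Zer T A N, Zer T N (Susp T A)) (f, g, h) (Idn T A, f, c)"
    by (rule TR3[OF TR1_idn[OF N] t]) (use f idn_hom[of A] in \<open>simp_all add: mem_Hom_iff\<close>)
  moreover have "Dom T g = B" "Cod T g = C" "Dom T h = C"
    using g tri_hom[OF t f g] by (simp_all add: mem_Hom_iff)
  ultimately obtain c where "c \<in> Hom T N C" "c \<cdot> Zer T A N = g \<cdot> f"
    using zer_hom[of N "Susp T A"] by (auto simp: triangle_mor_def mem_Hom_iff)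
  then show ?thesis using cmp_zer by metis
qed

text \<open>Compare the triangle with \<open>N \<rightarrow> U \<rightarrow> U\<close> for a zero object \<open>N\<close>.\<close>

lemma weak_cokernel:
  assumes t: "(f, g, h) \<in> Tri T" and f: "f \<in> Hom T A B" and g: "g \<in> Hom T B C"
    and u: "u \<in> Hom T B U" and uf: "u \<cdot> f = Zer T A U"
  obtains c where "c \<in> Hom T C U" "u = c \<cdot> g"
proof -
  obtain N where N: "zero_obj T N" using ex_zero_obj by blast
  have "\<exists>c. triangle_mor T (f, g, h) (Zer T N U, Idn T U, Zer T U (Susp T N)) (Zer T A N, u, c)"
  proof (rule TR3[OF t tri_zer_idn[OF N]])
    show "u \<cdot> f = Zer T N U \<cdot> Zer T A N" using uf cmp_zer[OF zer_hom] by simp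
  qed (use f u zer_hom in \<open>simp_all add: mem_Hom_iff\<close>)
  moreover have "Dom T h = C" using tri_hom[OF t f g] by (simp add: mem_Hom_iff)
  ultimately obtain c where "c \<in> Hom T C U" "c \<cdot> g = Idn T U \<cdot> u"
    using zer_hom[of U "Susp T N"] by (auto simp: triangle_mor_def mem_Hom_iff)
  then show ?thesis using that idn_cmp[OF u] by simp
qed

text \<open>
  Compare \<open>U \<rightarrow> N \<rightarrow> \<Sigma>U\<close> with the rotated triangle \<open>B \<rightarrow> C \<rightarrow> \<Sigma>A\<close>; the third component is the
  suspension of the required factor because the suspension is full.
\<close>

lemma weak_kernel:
  assumes t: "(f, g, h) \<in> Tri T" and f: "f \<in> Hom T A B" and g: "g \<in> Hom T B C"
    and u: "u \<in> Hom T U B" and gu: "g \<cdot> u = Zer T U C"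
  obtains v where "v \<in> Hom T U A" "u = f \<cdot> v"
proof -
  obtain N where N: "zero_obj T N" using ex_zero_obj by blast
  have h: "h \<in> Hom T C (Susp T A)" by (rule tri_hom[OF t f g])
  have Sf: "SuspM T f \<in> Hom T (Susp T A) (Susp T B)" by (rule susp_hom[OF f])
  have Su: "SuspM T u \<in> Hom T (Susp T U) (Susp T B)" by (rule susp_hom[OF u])
  let ?i = "Idn T (Susp T U)"
  have i: "?i \<in> Hom T (Susp T U) (Susp T U)" by (rule idn_hom)
  have "\<exists>c. triangle_mor T (Zer T U N, Zer T N (Susp T U), neg T (SuspM T (Idn T U)))
      (g, h, neg T (SuspM T f)) (u, Zer T N C, c)"
  proof (rule TR3[OF tri_rotate[OF TR1_idn[OF N]] tri_rotate[OF t]])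
    show "Zer T N C \<cdot> Zer T U N = g \<cdot> u" using gu cmp_zer[OF zer_hom] by simp
  qed (use f g u zer_hom in \<open>simp_all add: mem_Hom_iff\<close>)
  moreover have "Dom T (neg T (SuspM T f)) = Susp T A" "Dom T (neg T ?i) = Susp T U"
    using neg_hom[OF Sf] neg_hom[OF i] by (simp_all add: mem_Hom_iff)
  ultimately obtain c where c: "c \<in> Hom T (Susp T U) (Susp T A)"
    and eq: "SuspM T u \<cdot> neg T ?i = neg T (SuspM T f) \<cdot> c"
    by (auto simp: triangle_mor_def susp_idn)
  from susp_full[OF c] obtain v where v: "v \<in> Hom T U A" and cv: "c = SuspM T v" .
  have "neg T (SuspM T u) = neg T (SuspM T f \<cdot> c)"
    using eq cmp_neg[OF i Su] cmp_idn[OF Su] neg_cmp[OF c Sf] by simp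
  then have "SuspM T u = SuspM T f \<cdot> c"
    using neg_neg[OF Su] neg_neg[OF cmp_hom[OF c Sf]] by metis
  then have "u = f \<cdot> v"
    using susp_faithful[OF u cmp_hom[OF v f]] susp_cmp[OF v f] cv by simp
  then show ?thesis using that v by blast
qed

text \<open>
  The cone of \<open>w\<close> is replaced by an isomorphic suspension \<open>\<Sigma>M\<close>; as the suspension is full, its two
  remaining maps then have the form \<open>-\<Sigma>a\<close>, \<open>-\<Sigma>b\<close>, and the triangle can be rotated back twice.
\<close>

lemma ex_tri_third:
  assumes w: "w \<in> Hom T F (Susp T A)"
  obtains M a b where "a \<in> Hom T A M" "b \<in> Hom T M F" "(a, b, w) \<in> Tri T"
proof -
  obtain g h where t: "(w, g, h) \<in> Tri T" using TR1_ex by blast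
  obtain C where g: "g \<in> Hom T (Susp T A) C" and h: "h \<in> Hom T C (Susp T F)"
    using tri_candidate[OF t] w by (auto simp: candidate_def mem_Hom_iff)
  obtain M \<phi> \<psi> where \<phi>: "\<phi> \<in> Hom T (Susp T M) C" and \<psi>: "\<psi> \<in> Hom T C (Susp T M)"
    and \<psi>\<phi>: "\<psi> \<cdot> \<phi> = Idn T (Susp T M)" and \<phi>\<psi>: "\<phi> \<cdot> \<psi> = Idn T C"
    using susp_es[of C]
    by (auto simp: isomorphic_def iso_mor_def inverse_pair_def mem_Hom_iff)
  have iso_idn: "iso_mor T (Idn T D)" for D
    using idn_hom[of D] idn_cmp[OF idn_hom[of D]]
    by (auto simp: iso_mor_def inverse_pair_def mem_Hom_iff intro!: exI[of _ "Idn T D"])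
  have \<psi>g: "\<psi> \<cdot> g \<in> Hom T (Susp T A) (Susp T M)" by (rule cmp_hom[OF g \<psi>])
  have h\<phi>: "h \<cdot> \<phi> \<in> Hom T (Susp T M) (Susp T F)" by (rule cmp_hom[OF \<phi> h])
  have "(h \<cdot> \<phi>) \<cdot> \<psi> = h" using cmp_assoc[OF \<psi> \<phi> h] \<phi>\<psi> cmp_idn[OF h] by simp
  then have mor: "triangle_mor T (w, g, h) (w, \<psi> \<cdot> g, h \<cdot> \<phi>) (Idn T F, Idn T (Susp T A), \<psi>)"
    using w g h \<psi> \<psi>g h\<phi> idn_hom[of F] idn_hom[of "Susp T A"] idn_cmp[OF w] cmp_idn[OF w]
      cmp_idn[OF \<psi>g] idn_cmp[OF h] susp_idn[of F]
    by (simp add: triangle_mor_def mem_Hom_iff)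
  have iso: "iso_mor T \<psi>"
    using \<phi> \<psi> \<psi>\<phi> \<phi>\<psi> by (auto simp: iso_mor_def inverse_pair_def mem_Hom_iff)
  have "candidate T w (\<psi> \<cdot> g) (h \<cdot> \<phi>)"
    using w \<psi>g h\<phi> by (simp add: candidate_def mem_Hom_iff)
  from TR1_iso[OF t this mor iso_idn iso_idn iso]
  have t': "(w, \<psi> \<cdot> g, h \<cdot> \<phi>) \<in> Tri T" .
  obtain a where a: "a \<in> Hom T A M" "neg T (\<psi> \<cdot> g) = SuspM T a"
    using susp_full[OF neg_hom[OF \<psi>g]] by blast
  obtain b where b: "b \<in> Hom T M F" "neg T (h \<cdot> \<phi>) = SuspM T b"
    using susp_full[OF neg_hom[OF h\<phi>]] by blast
  have "(w, neg T (SuspM T a), neg T (SuspM T b)) \<in> Tri T"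
    using t' a(2) b(2) neg_neg[OF \<psi>g] neg_neg[OF h\<phi>] by metis
  then have "(b, w, neg T (SuspM T a)) \<in> Tri T"
    by (rule tri_rotate_back[OF _ b(1) w neg_hom[OF susp_hom[OF a(1)]]])
  then have "(a, b, w) \<in> Tri T" by (rule tri_rotate_back[OF _ a(1) b(1) w])
  then show ?thesis using that a(1) b(1) by blast
qed

text \<open>
  The octahedral axiom in terms of fibres: the fibre of \<open>h \<cdot> f\<close> is an extension of the fibre of \<open>h\<close> by
  the fibre of \<open>f\<close>. It comes from the axiom applied to \<open>\<delta> \<cdot> u\<close>, whose cone is \<open>\<Sigma>M\<close> if \<open>M\<close> is the
  extension of \<open>F\<close> by \<open>A\<close> with third map \<open>\<delta> \<cdot> u\<close>; applying the axiom to \<open>h \<cdot> f\<close> itself would produce the suspension of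
  the desired triangle.
\<close>

lemma octahedral_fibre:
  assumes t: "(p, f, \<delta>) \<in> Tri T" and p: "p \<in> Hom T A X" and f: "f \<in> Hom T X X'"
    and t': "(u, h, e) \<in> Tri T" and u: "u \<in> Hom T F X'" and h: "h \<in> Hom T X' W"
  obtains M a b v x where "a \<in> Hom T A M" "b \<in> Hom T M F" "(a, b, \<delta> \<cdot> u) \<in> Tri T"
    "v \<in> Hom T M X" "(v, h \<cdot> f, x) \<in> Tri T"
proof -
  have \<delta>: "\<delta> \<in> Hom T X' (Susp T A)" by (rule tri_hom[OF t p f])
  have e: "e \<in> Hom T W (Susp T F)" by (rule tri_hom[OF t' u h])
  have hf: "h \<cdot> f \<in> Hom T X W" by (rule cmp_hom[OF f h])
  obtain M a b where a: "a \<in> Hom T A M" and b: "b \<in> Hom T M F"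
    and ab: "(a, b, \<delta> \<cdot> u) \<in> Tri T"
    using ex_tri_third[OF cmp_hom[OF u \<delta>]] by blast
  have nf: "neg T (SuspM T f) \<in> Hom T (Susp T X) (Susp T X')"
    and nb: "neg T (SuspM T b) \<in> Hom T (Susp T M) (Susp T F)"
    by (intro neg_hom susp_hom f b)+
  obtain x y where xy: "(x, y, SuspM T h \<cdot> neg T (SuspM T f)) \<in> Tri T"
    and mx: "triangle_mor T (u, h, e) (\<delta> \<cdot> u, neg T (SuspM T a), neg T (SuspM T b))
      (Idn T (Dom T u), \<delta>, x)"
    and my: "triangle_mor T (\<delta> \<cdot> u, neg T (SuspM T a), neg T (SuspM T b))
      (\<delta>, neg T (SuspM T p), neg T (SuspM T f)) (u, Idn T (Cod T \<delta>), y)"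
    using TR4[of u \<delta> h e "neg T (SuspM T p)" "neg T (SuspM T f)"
        "neg T (SuspM T a)" "neg T (SuspM T b)"]
      t' tri_rotate[OF tri_rotate[OF t]] tri_rotate[OF tri_rotate[OF ab]] u \<delta>
    by (auto simp: mem_Hom_iff)
  have x: "x \<in> Hom T W (Susp T M)" and y: "y \<in> Hom T (Susp T M) (Susp T X)"
    using mx my e nf nb by (auto simp: triangle_mor_def mem_Hom_iff)
  obtain v where v: "v \<in> Hom T M X" "neg T y = SuspM T v"
    using susp_full[OF neg_hom[OF y]] by blast
  have "SuspM T h \<cdot> neg T (SuspM T f) = neg T (SuspM T (h \<cdot> f))"
    using cmp_neg[OF susp_hom[OF f] susp_hom[OF h]] susp_cmp[OF f h] by simp
  then have "(x, neg T (SuspM T v), neg T (SuspM T (h \<cdot> f))) \<in> Tri T"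
    using xy v(2) neg_neg[OF y] by metis
  then have "(h \<cdot> f, x, neg T (SuspM T v)) \<in> Tri T"
    by (rule tri_rotate_back[OF _ hf x neg_hom[OF susp_hom[OF v(1)]]])
  then have "(v, h \<cdot> f, x) \<in> Tri T" by (rule tri_rotate_back[OF _ v(1) hf x])
  then show ?thesis using that a b ab v(1) by blast
qed

end

section \<open>Powers of a projective class\<close>

locale stable_projective_class = triangulated_category +
  fixes P :: "'a set" and I :: "'b set"
  assumes projective_class: "projective_class T P I"
begin

lemma memP_iff: "A \<in> P \<longleftrightarrow> (\<forall>f \<in> I. \<forall>p \<in> Hom T A (Dom T f). f \<cdot> p = Zer T A (Cod T f))"
  using projective_class unfolding projective_class_def by blast

lemma memI_iff: "f \<in> I \<longleftrightarrow> (\<forall>A \<in> P. \<forall>p \<in> Hom T A (Dom T f). f \<cdot> p = Zer T A (Cod T f))"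
  using projective_class unfolding projective_class_def by blast

lemma P_cmp_I: "\<lbrakk>A \<in> P; f \<in> I; f \<in> Hom T X Y; p \<in> Hom T A X\<rbrakk> \<Longrightarrow> f \<cdot> p = Zer T A Y"
  using memP_iff by (auto simp: mem_Hom_iff)

lemma memI:
  assumes "f \<in> Hom T X Y" "\<And>A p. \<lbrakk>A \<in> P; p \<in> Hom T A X\<rbrakk> \<Longrightarrow> f \<cdot> p = Zer T A Y"
  shows "f \<in> I"
  using assms unfolding memI_iff by (auto simp: mem_Hom_iff)

lemma I_cmp_left:
  assumes fI: "f \<in> I" and f: "f \<in> Hom T X Y" and g: "g \<in> Hom T Y Z"
  shows "g \<cdot> f \<in> I"
proof (rule memI[OF cmp_hom[OF f g]])
  fix A p assume "A \<in> P" and p: "p \<in> Hom T A X"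
  then show "(g \<cdot> f) \<cdot> p = Zer T A Z"
    using cmp_assoc[OF p f g] P_cmp_I[OF _ fI f p] cmp_zer[OF g] by simp
qed

lemma I_cmp_right:
  assumes gI: "g \<in> I" and f: "f \<in> Hom T X Y" and g: "g \<in> Hom T Y Z"
  shows "g \<cdot> f \<in> I"
proof (rule memI[OF cmp_hom[OF f g]])
  fix A p assume "A \<in> P" and p: "p \<in> Hom T A X"
  then show "(g \<cdot> f) \<cdot> p = Zer T A Z"
    using cmp_assoc[OF p f g] P_cmp_I[OF _ gI g cmp_hom[OF p f]] by simp
qed

text \<open>
  Test on a projective \<open>A \<cong> \<Sigma>B\<close>. Every map \<open>\<Sigma>B \<rightarrow> \<Sigma>X\<close> is a suspension, and \<open>B\<close> is projective
  because \<open>P\<close> is closed under desuspension.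
\<close>

lemma I_susp:
  assumes fI: "f \<in> I" and f: "f \<in> Hom T X Y"
  shows "SuspM T f \<in> I"
proof (rule memI[OF susp_hom[OF f]])
  fix A p assume A: "A \<in> P" and p: "p \<in> Hom T A (Susp T X)"
  obtain B where iso: "isomorphic T (Susp T B) A" using susp_es by blast
  then have B: "B \<in> P" using A projective_class unfolding projective_class_def by blast
  obtain \<phi> \<psi> where \<phi>: "\<phi> \<in> Hom T (Susp T B) A" and \<psi>: "\<psi> \<in> Hom T A (Susp T B)"
    and \<phi>\<psi>: "\<phi> \<cdot> \<psi> = Idn T A"
    using iso by (auto simp: isomorphic_def iso_mor_def inverse_pair_def mem_Hom_iff)
  obtain q where q: "q \<in> Hom T B X" "p \<cdot> \<phi> = SuspM T q"
    using susp_full[OF cmp_hom[OF \<phi> p]] by blast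
  have Sq: "SuspM T q \<in> Hom T (Susp T B) (Susp T X)" by (rule susp_hom[OF q(1)])
  have "p = SuspM T q \<cdot> \<psi>"
    using q(2) cmp_assoc[OF \<psi> \<phi> p] \<phi>\<psi> cmp_idn[OF p] by simp
  then have "SuspM T f \<cdot> p = (SuspM T f \<cdot> SuspM T q) \<cdot> \<psi>"
    using cmp_assoc[OF \<psi> Sq susp_hom[OF f]] by simp
  also have "\<dots> = SuspM T (f \<cdot> q) \<cdot> \<psi>" using susp_cmp[OF q(1) f] by simp
  also have "\<dots> = Zer T A (Susp T Y)"
    using P_cmp_I[OF B fI f q(1)] susp_zer zer_cmp[OF \<psi>] by simp
  finally show "SuspM T f \<cdot> p = Zer T A (Susp T Y)" .
qed

text \<open>
  The recursion for \<open>ideal_pow\<close> has a separate clause at exponent one. The next two rules hide it by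
  means of identity factors. Their primed variants below split off the first instead of the last
  factor of a composite.
\<close>

lemma ideal_pow_cmp:
  assumes "f \<in> ideal_pow T I n" "f \<in> Hom T X Y" "g \<in> I" "g \<in> Hom T Y Z"
  shows "g \<cdot> f \<in> ideal_pow T I (Suc n)"
proof (cases n)
  case 0
  then show ?thesis using I_cmp_right[OF assms(3,2,4)] by simp
next
  case (Suc m)
  moreover have "Cod T f = Dom T g" using assms(2,4) by (simp add: mem_Hom_iff)
  ultimately show ?thesis using assms(1,3) by simp blast
qed

lemma ideal_pow_SucE:
  assumes "f \<in> ideal_pow T I (Suc n)" "f \<in> Hom T X Y"
  obtains W f1 f2 where "f1 \<in> ideal_pow T I n" "f1 \<in> Hom T X W" "f2 \<in> I" "f2 \<in> Hom T W Y"
    "f = f2 \<cdot> f1"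
proof (cases n)
  case 0
  then show ?thesis using that[of "Idn T X" X f] assms cmp_idn[OF assms(2)] idn_hom by simp
next
  case (Suc m)
  then obtain f1 f2 where f12: "f = f2 \<cdot> f1" "f1 \<in> ideal_pow T I n" "f2 \<in> I" "Cod T f1 = Dom T f2"
    using assms(1) by auto
  moreover have "f2 \<cdot> f1 \<in> Hom T (Dom T f1) (Cod T f2)"
    using cmp_hom[of f1 "Dom T f1" "Dom T f2" f2 "Cod T f2"] f12 by (simp add: mem_Hom_iff)
  ultimately show ?thesis using that[of f1 "Dom T f2" f2] assms(2) by (auto simp: mem_Hom_iff)
qed

lemma ideal_pow_zer: "Zer T X Y \<in> ideal_pow T I n"
proof (induction n)
  case (Suc n)
  have "Zer T Y Y \<in> I" by (rule memI[OF zer_hom zer_cmp])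
  then show ?case
    using ideal_pow_cmp[OF Suc.IH zer_hom _ zer_hom, of Y] cmp_zer[OF zer_hom, of Y Y X] by simp
qed simp

lemma ideal_pow_cmp_right:
  assumes "g \<in> ideal_pow T I n" "f \<in> Hom T X Y" "g \<in> Hom T Y Z"
  shows "g \<cdot> f \<in> ideal_pow T I n"
  using assms
proof (induction n arbitrary: g Z)
  case 0
  then show ?case by simp
next
  case (Suc n)
  obtain W g1 g2 where g: "g1 \<in> ideal_pow T I n" "g1 \<in> Hom T Y W" "g2 \<in> I" "g2 \<in> Hom T W Z"
    "g = g2 \<cdot> g1"
    using ideal_pow_SucE[OF Suc.prems(1,3)] .
  have "g2 \<cdot> (g1 \<cdot> f) \<in> ideal_pow T I (Suc n)"
    by (rule ideal_pow_cmp[OF Suc.IH[OF g(1) Suc.prems(2) g(2)] cmp_hom[OF Suc.prems(2) g(2)]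
          g(3,4)])
  then show ?case using cmp_assoc[OF Suc.prems(2) g(2,4)] g(5) by simp
qed

lemma ideal_pow_cmp_left:
  assumes "f \<in> ideal_pow T I n" "f \<in> Hom T X Y" "g \<in> Hom T Y Z"
  shows "g \<cdot> f \<in> ideal_pow T I n"
proof (cases n)
  case 0
  then show ?thesis by simp
next
  case (Suc m)
  obtain W f1 f2 where f: "f1 \<in> ideal_pow T I m" "f1 \<in> Hom T X W" "f2 \<in> I" "f2 \<in> Hom T W Y"
    "f = f2 \<cdot> f1"
    using ideal_pow_SucE[OF assms(1)[unfolded Suc] assms(2)] .
  have "(g \<cdot> f2) \<cdot> f1 \<in> ideal_pow T I (Suc m)"
    by (rule ideal_pow_cmp[OF f(1,2) I_cmp_left[OF f(3,4) assms(3)] cmp_hom[OF f(4) assms(3)]])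
  then show ?thesis using cmp_assoc[OF f(2,4) assms(3)] f(5) Suc by simp
qed

lemma ideal_pow_cmp':
  assumes "f \<in> I" "f \<in> Hom T X Y" "g \<in> ideal_pow T I n" "g \<in> Hom T Y Z"
  shows "g \<cdot> f \<in> ideal_pow T I (Suc n)"
  using assms(3,4)
proof (induction n arbitrary: g Z)
  case 0
  then show ?case using I_cmp_left[OF assms(1,2)] by simp
next
  case (Suc n)
  obtain W g1 g2 where g: "g1 \<in> ideal_pow T I n" "g1 \<in> Hom T Y W" "g2 \<in> I" "g2 \<in> Hom T W Z"
    "g = g2 \<cdot> g1"
    using ideal_pow_SucE[OF Suc.prems] .
  have "g2 \<cdot> (g1 \<cdot> f) \<in> ideal_pow T I (Suc (Suc n))"
    by (rule ideal_pow_cmp[OF Suc.IH[OF g(1,2)] cmp_hom[OF assms(2) g(2)] g(3,4)])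
  then show ?case using cmp_assoc[OF assms(2) g(2,4)] g(5) by simp
qed

lemma ideal_pow_SucE':
  assumes "f \<in> ideal_pow T I (Suc n)" "f \<in> Hom T X Y"
  obtains W f1 f2 where "f1 \<in> I" "f1 \<in> Hom T X W" "f2 \<in> ideal_pow T I n" "f2 \<in> Hom T W Y"
    "f = f2 \<cdot> f1"
  using assms
proof (induction n arbitrary: f Y thesis)
  case 0
  then show ?case using "0.prems"(1)[of f Y "Idn T Y"] idn_cmp[OF "0.prems"(3)] idn_hom by simp
next
  case (Suc n)
  obtain W g f2 where g: "g \<in> ideal_pow T I (Suc n)" "g \<in> Hom T X W" "f2 \<in> I" "f2 \<in> Hom T W Y"
    "f = f2 \<cdot> g"
    using ideal_pow_SucE[OF Suc.prems(2,3)] .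
  obtain V g1 g2 where g12: "g1 \<in> I" "g1 \<in> Hom T X V" "g2 \<in> ideal_pow T I n" "g2 \<in> Hom T V W"
    "g = g2 \<cdot> g1"
    using Suc.IH[OF _ g(1,2)] by blast
  show ?case
    by (rule Suc.prems(1)[OF g12(1,2) ideal_pow_cmp[OF g12(3,4) g(3,4)] cmp_hom[OF g12(4) g(4)]])
      (simp add: g(5) g12(5) cmp_assoc[OF g12(2,4) g(4)])
qed

lemma ideal_pow_antimono:
  assumes "m \<le> n"
  shows "ideal_pow T I n \<subseteq> ideal_pow T I m"
  using assms
proof (induction n rule: dec_induct)
  case base
  show ?case by simp
next
  case (step n)
  have "f \<in> ideal_pow T I n" if fn: "f \<in> ideal_pow T I (Suc n)" for f
  proof -
    have f: "f \<in> Hom T (Dom T f) (Cod T f)" by (simp add: mem_Hom_iff)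
    obtain W f1 f2 where "f1 \<in> ideal_pow T I n" "f1 \<in> Hom T (Dom T f) W"
      "f2 \<in> Hom T W (Cod T f)" "f = f2 \<cdot> f1"
      using ideal_pow_SucE[OF fn f] by blast
    then show ?thesis using ideal_pow_cmp_left by simp
  qed
  then show ?case using step.IH by blast
qed

lemma proj_pow_retract:
  assumes "retract T X Y" "Y \<in> proj_pow T P n"
  shows "X \<in> proj_pow T P n"
proof (cases "(T, P, n)" rule: proj_pow.cases)
  case 1
  then show ?thesis using assms zero_obj_if_retract by auto
next
  case 2
  then have Y: "Y \<in> P" using assms(2) by simp
  obtain i r where i: "i \<in> Hom T X Y" and r: "r \<in> Hom T Y X" and ri: "r \<cdot> i = Idn T X"
    using assms(1) by (auto simp: retract_def)
  have "f \<cdot> p = Zer T X (Cod T f)" if "f \<in> I" and p: "p \<in> Hom T X (Dom T f)" for f p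
  proof -
    have f: "f \<in> Hom T (Dom T f) (Cod T f)" by (simp add: mem_Hom_iff)
    have "f \<cdot> p = f \<cdot> ((p \<cdot> r) \<cdot> i)" using cmp_assoc[OF i r p] ri cmp_idn[OF p] by simp
    also have "\<dots> = (f \<cdot> (p \<cdot> r)) \<cdot> i" using cmp_assoc[OF i cmp_hom[OF r p] f] by simp
    also have "\<dots> = Zer T X (Cod T f)"
      using P_cmp_I[OF Y \<open>f \<in> I\<close> f cmp_hom[OF r p]] zer_cmp[OF i] by simp
    finally show ?thesis .
  qed
  then show ?thesis using 2 memP_iff by simp
next
  case (3 T' P' m)
  then obtain M A Q f g h where "retract T Y M" "A \<in> P" "Q \<in> proj_pow T P (Suc m)"
    "f \<in> Hom T A M" "g \<in> Hom T M Q" "(f, g, h) \<in> Tri T"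
    using assms(2) by auto
  then show ?thesis using 3 retract_trans[OF assms(1)] by simp blast
qed

text \<open>
  On an extension \<open>A \<rightarrow> M \<rightarrow> Q\<close>, the first factor of a map in \<open>I\<^sup>n\<^sup>+\<^sup>1\<close> kills \<open>A\<close>, so that it factors
  through \<open>Q\<close>, which the other \<open>n\<close> factors kill by induction.
\<close>

lemma proj_pow_ideal_pow_zer:
  assumes "X \<in> proj_pow T P n" "f \<in> ideal_pow T I n" "f \<in> Hom T X Y"
  shows "f = Zer T X Y"
  using assms
proof (induction n arbitrary: X f Y)
  case 0
  then show ?case using zero_obj_hom(1) by simp
next
  case (Suc n)
  obtain W f1 f2 where f1I: "f1 \<in> I" and f1: "f1 \<in> Hom T X W"
    and f2: "f2 \<in> ideal_pow T I n" "f2 \<in> Hom T W Y" and f: "f = f2 \<cdot> f1"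
    using ideal_pow_SucE'[OF Suc.prems(2,3)] .
  show ?case
  proof (cases n)
    case 0
    then have "f \<cdot> Idn T X = Zer T X Y"
      using P_cmp_I[OF _ _ Suc.prems(3) idn_hom] Suc.prems(1,2) by simp
    then show ?thesis using cmp_idn[OF Suc.prems(3)] by simp
  next
    case (Suc m)
    then obtain M A Q a g h where "retract T X M" and A: "A \<in> P" and Q: "Q \<in> proj_pow T P n"
      and a: "a \<in> Hom T A M" and g: "g \<in> Hom T M Q" and t: "(a, g, h) \<in> Tri T"
      using Suc.prems(1) by auto
    then obtain i r where i: "i \<in> Hom T X M" and r: "r \<in> Hom T M X" and ri: "r \<cdot> i = Idn T X"
      by (auto simp: retract_def)
    have f1r: "f1 \<cdot> r \<in> Hom T M W" by (rule cmp_hom[OF r f1])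
    have "(f1 \<cdot> r) \<cdot> a = Zer T A W"
      by (rule P_cmp_I[OF A I_cmp_right[OF f1I r f1] f1r a])
    then obtain c where c: "c \<in> Hom T Q W" "f1 \<cdot> r = c \<cdot> g"
      using weak_cokernel[OF t a g f1r] by blast
    have "f2 \<cdot> c = Zer T Q Y"
      by (rule Suc.IH[OF Q ideal_pow_cmp_right[OF f2(1) c(1) f2(2)] cmp_hom[OF c(1) f2(2)]])
    then have fr: "f2 \<cdot> (f1 \<cdot> r) = Zer T M Y"
      using c(2) cmp_assoc[OF g c(1) f2(2)] zer_cmp[OF g] by simp
    have "f1 = (f1 \<cdot> r) \<cdot> i" using cmp_assoc[OF i r f1] ri cmp_idn[OF f1] by simp
    then have "f = (f2 \<cdot> (f1 \<cdot> r)) \<cdot> i" using f cmp_assoc[OF i f1r f2(2)] by simp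
    then show ?thesis using fr zer_cmp[OF i] by simp
  qed
qed

text \<open>
  This is the third axiom of a projective class for \<open>(P\<^sub>n, I\<^sup>n)\<close>: splice \<open>n\<close> projective
  presentations, starting with that of \<open>X\<close>.
\<close>

lemma ex_proj_pow_tri:
  obtains F W u h e where "F \<in> proj_pow T P n" "h \<in> ideal_pow T I n"
    "u \<in> Hom T F X" "h \<in> Hom T X W" "(u, h, e) \<in> Tri T"
proof (induction n arbitrary: X thesis)
  case 0
  obtain N where N: "zero_obj T N" using ex_zero_obj by blast
  show ?case by (rule 0[OF _ _ zer_hom idn_hom tri_zer_idn[OF N]]) (simp_all add: N)
next
  case (Suc n)
  obtain A X' p f \<delta> where A: "A \<in> P" and fI: "f \<in> I" and p: "p \<in> Hom T A X"
    and f: "f \<in> Hom T X X'" and t: "(p, f, \<delta>) \<in> Tri T"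
    using projective_class unfolding projective_class_def by meson
  show ?case
  proof (cases n)
    case 0
    then show ?thesis using Suc.prems[OF _ _ p f t] A fI by simp
  next
    case (Suc m)
    obtain F W u h e where F: "F \<in> proj_pow T P n" and hI: "h \<in> ideal_pow T I n"
      and u: "u \<in> Hom T F X'" and h: "h \<in> Hom T X' W" and t': "(u, h, e) \<in> Tri T"
      by (rule Suc.IH)
    obtain M a b v x where a: "a \<in> Hom T A M" and b: "b \<in> Hom T M F"
      and ab: "(a, b, \<delta> \<cdot> u) \<in> Tri T" and v: "v \<in> Hom T M X" and vx: "(v, h \<cdot> f, x) \<in> Tri T"
      by (rule octahedral_fibre[OF t p f t' u h])
    have "retract T M M" using idn_hom cmp_idn[OF idn_hom] by (auto simp: retract_def)
    then have "M \<in> proj_pow T P (Suc n)" using A F a b ab Suc by simp blast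
    then show ?thesis
      using Suc.prems[OF _ ideal_pow_cmp'[OF fI f hI h] v cmp_hom[OF f h] vx] by blast
  qed
qed

text \<open>
  If the map out of \<open>X\<close> in the triangle of \<open>ex_proj_pow_tri\<close> vanishes, then \<open>X\<close> is a retract of its
  fibre \<open>F\<close>.
\<close>

lemma proj_powI:
  assumes "\<And>f Y. \<lbrakk>f \<in> ideal_pow T I n; f \<in> Hom T X Y\<rbrakk> \<Longrightarrow> f = Zer T X Y"
  shows "X \<in> proj_pow T P n"
proof -
  obtain F W u h e where F: "F \<in> proj_pow T P n" and hI: "h \<in> ideal_pow T I n"
    and u: "u \<in> Hom T F X" and h: "h \<in> Hom T X W" and t: "(u, h, e) \<in> Tri T"
    by (rule ex_proj_pow_tri)
  have "h \<cdot> Idn T X = Zer T X W" using assms[OF hI h] cmp_idn[OF h] by simp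
  then obtain s where "s \<in> Hom T X F" "Idn T X = u \<cdot> s"
    using weak_kernel[OF t u h idn_hom] by blast
  then have "retract T X F" using u by (auto simp: retract_def)
  then show ?thesis using proj_pow_retract F by blast
qed

lemma proj_pow_len: "len T P X = enat n \<Longrightarrow> X \<in> proj_pow T P n"
  by (auto simp: len_def split: if_splits intro: LeastI)

lemma len_le: "X \<in> proj_pow T P n \<Longrightarrow> len T P X \<le> enat n"
  by (auto simp: len_def intro: Least_le)

section \<open>Triangles ending in a right almost split map\<close>

text \<open>
  As \<open>Z\<close> is not in \<open>P\<^sub>n\<close>, the fibre of a universal map \<open>h\<close> in \<open>I\<^sup>n\<close> from \<open>Z\<close> maps to \<open>Z\<close> without being
  split epic, hence through \<open>\<beta>\<close>. A map that vanishes on it factors through \<open>h\<close>.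
\<close>

lemma ideal_pow_if_cmp_right_almost_split:
  assumes ras: "right_almost_split T \<beta>" and \<beta>: "\<beta> \<in> Hom T Y Z"
    and Z: "Z \<notin> proj_pow T P n"
    and t: "t \<in> Hom T Z W" and t\<beta>: "t \<cdot> \<beta> \<in> ideal_pow T I n"
  shows "t \<in> ideal_pow T I n"
proof -
  obtain F V u h e where F: "F \<in> proj_pow T P n" and hI: "h \<in> ideal_pow T I n"
    and u: "u \<in> Hom T F Z" and h: "h \<in> Hom T Z V" and tri: "(u, h, e) \<in> Tri T"
    by (rule ex_proj_pow_tri)
  have "\<not> split_epi T u"
  proof
    assume "split_epi T u"
    then obtain s where "s \<in> Hom T Z F" "u \<cdot> s = Idn T Z"
      using u by (auto simp: split_epi_def mem_Hom_iff)
    then have "retract T Z F" using u by (auto simp: retract_def)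
    then show False using proj_pow_retract F Z by blast
  qed
  then obtain g where g: "g \<in> Hom T F Y" "\<beta> \<cdot> g = u"
    using ras u \<beta> by (auto simp: right_almost_split_def mem_Hom_iff)
  have tb: "t \<cdot> \<beta> \<in> Hom T Y W" by (rule cmp_hom[OF \<beta> t])
  have "(t \<cdot> \<beta>) \<cdot> g = Zer T F W"
    by (rule proj_pow_ideal_pow_zer[OF F ideal_pow_cmp_right[OF t\<beta> g(1) tb] cmp_hom[OF g(1) tb]])
  then have "t \<cdot> u = Zer T F W" using cmp_assoc[OF g(1) \<beta> t] g(2) by simp
  then obtain c where "c \<in> Hom T V W" "t = c \<cdot> h"
    using weak_cokernel[OF tri u h t] by blast
  then show ?thesis using ideal_pow_cmp_left[OF hI h] by simp
qed

end

locale right_almost_split_triangle = stable_projective_class +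
  fixes X Y Z :: 'a and \<alpha> \<beta> \<gamma> :: 'b and l k :: nat
  assumes \<alpha>: "\<alpha> \<in> Hom T X Y" and \<beta>: "\<beta> \<in> Hom T Y Z"
    and tri: "(\<alpha>, \<beta>, \<gamma>) \<in> Tri T"
    and ras: "right_almost_split T \<beta>"
    and len_Z: "len T P Z = enat l" and len_X: "len T P X = enat k"
begin

lemma \<gamma>: "\<gamma> \<in> Hom T Z (Susp T X)"
  by (rule tri_hom[OF tri \<alpha> \<beta>])

lemma tri': "(\<beta>, \<gamma>, neg T (SuspM T \<alpha>)) \<in> Tri T"
  by (rule tri_rotate[OF tri])

lemma Z_l: "Z \<in> proj_pow T P l"
  by (rule proj_pow_len[OF len_Z])

text \<open>A map to a zero object is split epic, but \<open>\<beta>\<close> is not.\<close>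

lemma l_pos: "0 < l"
proof (rule ccontr)
  assume "\<not> 0 < l"
  then have Z: "zero_obj T Z" using Z_l by simp
  have "\<beta> \<cdot> Zer T Z Y = Idn T Z"
    using cmp_zer[OF \<beta>] zero_obj_hom(1)[OF Z idn_hom] by simp
  then have "split_epi T \<beta>" using \<beta> zer_hom[of Z Y] by (auto simp: split_epi_def mem_Hom_iff)
  then show False using ras by (simp add: right_almost_split_def)
qed

lemma Z_not_pred: "Z \<notin> proj_pow T P (l - 1)"
  using len_le[of Z "l - 1"] len_Z l_pos by auto

lemma \<gamma>_ideal_pow: "\<gamma> \<in> ideal_pow T I (l - 1)"
proof (rule ideal_pow_if_cmp_right_almost_split[OF ras \<beta> Z_not_pred \<gamma>])
  show "\<gamma> \<cdot> \<beta> \<in> ideal_pow T I (l - 1)"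
    using tri_cmp_zer[OF tri' \<beta> \<gamma>] ideal_pow_zer by simp
qed

text \<open>
  Of a map \<open>f\<^sub>2 f\<^sub>1\<close> in \<open>I\<^sup>n\<close>, the factor \<open>f\<^sub>1\<close> in \<open>I\<^sup>n\<^sup>-\<^sup>1\<close> kills \<open>X\<close>, so that it is \<open>t \<cdot> \<beta>\<close> for some
  \<open>t\<close>, which is in \<open>I\<^sup>l\<^sup>-\<^sup>1\<close>. Hence \<open>f\<^sub>2 t\<close> is in \<open>I\<^sup>l\<close> and vanishes on \<open>Z\<close>.
\<close>

lemma Y_proj_pow: "Y \<in> proj_pow T P (max (k + 1) l)"
proof (rule proj_powI)
  fix f W assume fI: "f \<in> ideal_pow T I (max (k + 1) l)" and f: "f \<in> Hom T Y W"
  define n where "n = max k (l - 1)"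
  have "max (k + 1) l = Suc n" using l_pos by (simp add: n_def)
  with fI have "f \<in> ideal_pow T I (Suc n)" by simp
  then obtain V f1 f2 where f1I: "f1 \<in> ideal_pow T I n" and f1: "f1 \<in> Hom T Y V"
    and f2I: "f2 \<in> I" and f2: "f2 \<in> Hom T V W" and f_eq: "f = f2 \<cdot> f1"
    using ideal_pow_SucE[OF _ f] by blast
  have "f1 \<in> ideal_pow T I k" "f1 \<in> ideal_pow T I (l - 1)"
    using f1I ideal_pow_antimono[of k n] ideal_pow_antimono[of "l - 1" n] by (auto simp: n_def)
  then have "f1 \<cdot> \<alpha> = Zer T X V"
    using proj_pow_ideal_pow_zer[OF proj_pow_len[OF len_X] ideal_pow_cmp_right[OF _ \<alpha> f1]]
      cmp_hom[OF \<alpha> f1] by blast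
  then obtain t where t: "t \<in> Hom T Z V" "f1 = t \<cdot> \<beta>"
    using weak_cokernel[OF tri \<alpha> \<beta> f1] by blast
  have "t \<in> ideal_pow T I (l - 1)"
    using ideal_pow_if_cmp_right_almost_split[OF ras \<beta> Z_not_pred t(1)] t(2)
      \<open>f1 \<in> ideal_pow T I (l - 1)\<close> by simp
  then have "f2 \<cdot> t \<in> ideal_pow T I l"
    using ideal_pow_cmp[OF _ t(1) f2I f2] l_pos by fastforce
  then have "f2 \<cdot> t = Zer T Z W"
    by (rule proj_pow_ideal_pow_zer[OF Z_l _ cmp_hom[OF t(1) f2]])
  then show "f = Zer T Y W"
    using f_eq t(2) cmp_assoc[OF \<beta> t(1) f2] zer_cmp[OF \<beta>] by simp
qed

text \<open>
  Of a map \<open>f\<^sub>2 f\<^sub>1\<close> in \<open>I\<^sup>m\<^sup>+\<^sup>1\<close>, the factor \<open>f\<^sub>1\<close> in \<open>I\<^sup>m\<close> kills \<open>Y\<close>, so that it is a multiple of \<open>\<gamma>\<close>,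
  which is in \<open>I\<^sup>l\<^sup>-\<^sup>1\<close>. Hence \<open>f\<^sub>2 f\<^sub>1\<close> is in \<open>I\<^sup>l\<close> and vanishes on \<open>Z\<close>.
\<close>

lemma Z_proj_pow_Suc:
  assumes Y: "Y \<in> proj_pow T P m"
  shows "Z \<in> proj_pow T P (Suc m)"
proof (rule proj_powI)
  fix f W assume fI: "f \<in> ideal_pow T I (Suc m)" and f: "f \<in> Hom T Z W"
  obtain V f1 f2 where f1I: "f1 \<in> ideal_pow T I m" and f1: "f1 \<in> Hom T Z V"
    and f2I: "f2 \<in> I" and f2: "f2 \<in> Hom T V W" and f_eq: "f = f2 \<cdot> f1"
    using ideal_pow_SucE[OF fI f] .
  have "f1 \<cdot> \<beta> = Zer T Y V"
    by (rule proj_pow_ideal_pow_zer[OF Y ideal_pow_cmp_right[OF f1I \<beta> f1] cmp_hom[OF \<beta> f1]])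
  then obtain c where c: "c \<in> Hom T (Susp T X) V" "f1 = c \<cdot> \<gamma>"
    using weak_cokernel[OF tri' \<beta> \<gamma> f1] by blast
  have "f1 \<in> ideal_pow T I (l - 1)"
    using ideal_pow_cmp_left[OF \<gamma>_ideal_pow \<gamma> c(1)] c(2) by simp
  then have "f \<in> ideal_pow T I l"
    using ideal_pow_cmp[OF _ f1 f2I f2] l_pos f_eq by fastforce
  then show "f = Zer T Z W" by (rule proj_pow_ideal_pow_zer[OF Z_l _ f])
qed

text \<open>
  Of a map \<open>f\<^sub>2 f\<^sub>1\<close> in \<open>I\<^sup>m\<^sup>+\<^sup>1\<close>, now with \<open>f\<^sub>1\<close> in \<open>I\<close>, the composite \<open>\<Sigma>f\<^sub>1 \<cdot> \<gamma>\<close> is in \<open>I\<^sup>l\<close> and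
  vanishes on \<open>Z\<close>. So \<open>f\<^sub>1\<close> factors through \<open>\<alpha>\<close>, and \<open>f\<^sub>2\<close> in \<open>I\<^sup>m\<close> kills \<open>Y\<close>.
\<close>

lemma X_proj_pow_Suc:
  assumes Y: "Y \<in> proj_pow T P m"
  shows "X \<in> proj_pow T P (Suc m)"
proof (rule proj_powI)
  fix f W assume fI: "f \<in> ideal_pow T I (Suc m)" and f: "f \<in> Hom T X W"
  obtain V f1 f2 where f1I: "f1 \<in> I" and f1: "f1 \<in> Hom T X V"
    and f2I: "f2 \<in> ideal_pow T I m" and f2: "f2 \<in> Hom T V W" and f_eq: "f = f2 \<cdot> f1"
    using ideal_pow_SucE'[OF fI f] .
  have Sf1: "SuspM T f1 \<in> Hom T (Susp T X) (Susp T V)" by (rule susp_hom[OF f1])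
  have S\<alpha>: "SuspM T \<alpha> \<in> Hom T (Susp T X) (Susp T Y)" by (rule susp_hom[OF \<alpha>])
  have "SuspM T f1 \<cdot> \<gamma> \<in> ideal_pow T I l"
    using ideal_pow_cmp[OF \<gamma>_ideal_pow \<gamma> I_susp[OF f1I f1] Sf1] l_pos by simp
  then have "SuspM T f1 \<cdot> \<gamma> = Zer T Z (Susp T V)"
    by (rule proj_pow_ideal_pow_zer[OF Z_l _ cmp_hom[OF \<gamma> Sf1]])
  then obtain c where c: "c \<in> Hom T (Susp T Y) (Susp T V)"
    and Sf1_eq: "SuspM T f1 = c \<cdot> neg T (SuspM T \<alpha>)"
    using weak_cokernel[OF tri_rotate[OF tri'] \<gamma> neg_hom[OF S\<alpha>] Sf1] by blast
  obtain d where d: "d \<in> Hom T Y V" "c = SuspM T d" using susp_full[OF c] .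
  have nd: "neg T d \<in> Hom T Y V" by (rule neg_hom[OF d(1)])
  have "SuspM T f1 = SuspM T (neg T d \<cdot> \<alpha>)"
    using Sf1_eq d(2) cmp_neg[OF S\<alpha> c] neg_cmp[OF S\<alpha> c] susp_cmp[OF \<alpha> nd] susp_neg[OF d(1)] by simp
  then have f1_eq: "f1 = neg T d \<cdot> \<alpha>" by (rule susp_faithful[OF f1 cmp_hom[OF \<alpha> nd]])
  have "f2 \<cdot> neg T d = Zer T Y W"
    by (rule proj_pow_ideal_pow_zer[OF Y ideal_pow_cmp_right[OF f2I nd f2] cmp_hom[OF nd f2]])
  then show "f = Zer T X W"
    using f_eq f1_eq cmp_assoc[OF \<alpha> nd f2] zer_cmp[OF \<alpha>] by simp
qed

lemma len_lower_bounds: "enat (k - 1) \<le> len T P Y" "enat (l - 1) \<le> len T P Y"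
proof -
  have "k - 1 \<le> m \<and> l - 1 \<le> m" if "len T P Y = enat m" for m
    using len_le[OF X_proj_pow_Suc[OF proj_pow_len[OF that]]]
      len_le[OF Z_proj_pow_Suc[OF proj_pow_len[OF that]]] len_X len_Z by auto
  then show "enat (k - 1) \<le> len T P Y" "enat (l - 1) \<le> len T P Y"
    by (cases "len T P Y"; simp)+
qed

lemma len_summand: "summand T S Y \<Longrightarrow> len T P S \<le> enat (max (k + 1) l)"
  using len_le[OF proj_pow_retract[OF _ Y_proj_pow]]
  by (auto simp: summand_def biproduct_def retract_def)

end

theorem proposition3p6:
  fixes T :: "('o, 'm) tricat" and P :: "'o set" and I :: "'m set"
    and X Y Z :: 'o and \<alpha> \<beta> \<gamma> :: 'm and k l :: nat
  assumes "triangulated_category T"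
    and "projective_class T P I"
    and "\<alpha> \<in> Hom T X Y" and "\<beta> \<in> Hom T Y Z" and "\<gamma> \<in> Hom T Z (Susp T X)"
    and "(\<alpha>, \<beta>, \<gamma>) \<in> Tri T"
    and "right_almost_split T \<beta>"
    and "len T P Z = enat l"
    and "len T P X = enat k"
  shows "\<gamma> \<in> ideal_pow T I (l - 1)
    \<and> (k \<ge> l \<longrightarrow> enat (k - 1) \<le> len T P Y \<and> len T P Y \<le> enat (k + 1))
    \<and> (k \<le> l - 1 \<longrightarrow> enat (l - 1) \<le> len T P Y \<and> len T P Y \<le> enat l)
    \<and> (\<forall>S. summand T S Y \<longrightarrow> len T P S \<le> enat (max (k + 1) l))"
proof -
  interpret right_almost_split_triangle T P I X Y Z \<alpha> \<beta> \<gamma> l k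
    using assms by (simp add: right_almost_split_triangle_def stable_projective_class_def
        stable_projective_class_axioms_def right_almost_split_triangle_axioms_def)
  have "k \<ge> l \<Longrightarrow> max (k + 1) l = k + 1" "k \<le> l - 1 \<Longrightarrow> max (k + 1) l = l"
    using l_pos by simp_all
  then show ?thesis
    using \<gamma>_ideal_pow len_lower_bounds len_le[OF Y_proj_pow] len_summand by metis
qed

end
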